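(* Let $\mathcal{F}$ be a family of subsets of $\mathbb{N}$ with the Ramsey property which is inverse shift invariant and dilation invariant and such that $\beta(\mathcal{F})$ is a subsemigroup of $(\beta\mathbb{N},+)$. Let $\langle x_n\rangle_{n=1}^{\infty}$ be an $\mathcal{F}$-minimal sequence in $\mathbb{N}$ and let $A$ be an essential $\mathcal{F}^{\star}$-set in $(\mathbb{N},+)$. Then there exists a sum subsystem $\langle y_n\rangle_{n=1}^{\infty}$ of $\langle x_n\rangle_{n=1}^{\infty}$ such that $$FS(\langle y_n\rangle_{n=1}^{\infty})\cup FP(\langle y_n\rangle_{n=1}^{\infty})\subseteq A.$$
   Context: $\mathbb{N}=\{1,2,3,\dots\}$. A family on $\mathbb{N}$ is a non-empty collection $\mathcal{F}\subseteq\mathcal{P}(\mathbb{N})\setminus\{\emptyset\}$ closed under supersets within $\mathbb{N}$. $\mathcal{F}$ has the Ramsey property if whenever $A\in\mathcal{F}$ and $A=A_1\cup A_2$, some $A_i\in\mathcal{F}$. $\mathcal{F}$ is inverse shift invariant if $-s+E=\{n\in\mathbb{N}: s+n\in E\}\in\mathcal{F}$ for all $s\in\mathbb{N}$, $E\in\mathcal{F}$. $\mathcal{F}$ is dilation invariant if $nE=\{nk:k\in E\}\in\mathcal{F}$ for all $n\in\mathbb{N}$, $E\in\mathcal{F}$. $\beta\mathbb{N}$ is the set of ultrafilters on $\mathbb{N}$ (Stone-Čech compactification of discrete $\mathbb{N}$) with $A\in p+q$ iff $\{n\in\mathbb{N}: -n+A\in q\}\in p$. Put $\beta(\mathcal{F})=\{p\in\beta\mathbb{N}: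 p\subseteq\mathcal{F}\}$. A set $A\subseteq\mathbb{N}$ is an essential $\mathcal{F}^{\star}$-set in $(\mathbb{N},+)$ if $A\in p$ for every idempotent $p$ of $(\beta(\mathcal{F}),+)$. For a sequence $\langle x_n\rangle_{n=m}^{\infty}$ in $\mathbb{N}$, $FS(\langle x_n\rangle_{n=m}^{\infty})$ (resp. $FP(\langle x_n\rangle_{n=m}^{\infty})$) is the set of all sums $\sum_{n\in F}x_n$ (resp. products $\prod_{n\in F}x_n$) over non-empty finite $F\subseteq\{m,m+1,\dots\}$. The sequence $\langle x_n\rangle_{n=1}^{\infty}$ is $\mathcal{F}$-minimal if $\bigcap_{m=1}^{\infty}\mathrm{cl}(FS(\langle x_n\rangle_{n=m}^{\infty}))\cap\beta(\mathcal{F})\neq\emptyset$, where $\mathrm{cl}(B)=\{p\in\beta\mathbb{N}: B\in p\}$. A sequence $\langle y_n\rangle_{n=1}^{\infty}$ is a sum subsystem of $\langle x_n\rangle_{n=1}^{\infty}$ if there are non-empty finite sets $H_n\subseteq\mathbb{N}$ with $\max H_n<\min H_{n+1}$ and $y_n=\sum_{t\in H_n}x_t$ for each $n\in\mathbb{N}$. *)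

theory Defs
  imports Main
begin

text \<open>The natural numbers are \<open>{1, 2, 3, \<dots>}\<close>, represented as a subset of \<^typ>\<open>nat\<close>.\<close>

abbreviation pos_nats :: "nat set" where
  "pos_nats \<equiv> {0<..}"

definition neg_shift :: "nat \<Rightarrow> nat set \<Rightarrow> nat set" where
  "neg_shift s E = {n \<in> pos_nats. s + n \<in> E}"

definition dilate :: "nat \<Rightarrow> nat set \<Rightarrow> nat set" where
  "dilate n E = {n * k |k. k \<in> E}"

definition is_family :: "nat set set \<Rightarrow> bool" where
  "is_family \<F> \<longleftrightarrow>
     \<F> \<noteq> {} \<and> \<F> \<subseteq> Pow pos_nats - {{}} \<and>
     (\<forall>A B. A \<in> \<F> \<and> A \<subseteq> B \<and> B \<subseteq> pos_nats \<longrightarrow> B \<in> \<F>)"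

definition ramsey_property :: "nat set set \<Rightarrow> bool" where
  "ramsey_property \<F> \<longleftrightarrow>
     (\<forall>A A1 A2. A \<in> \<F> \<and> A = A1 \<union> A2 \<longrightarrow> A1 \<in> \<F> \<or> A2 \<in> \<F>)"

definition inverse_shift_invariant :: "nat set set \<Rightarrow> bool" where
  "inverse_shift_invariant \<F> \<longleftrightarrow> (\<forall>s\<in>pos_nats. \<forall>E\<in>\<F>. neg_shift s E \<in> \<F>)"

definition dilation_invariant :: "nat set set \<Rightarrow> bool" where
  "dilation_invariant \<F> \<longleftrightarrow> (\<forall>n\<in>pos_nats. \<forall>E\<in>\<F>. dilate n E \<in> \<F>)"

text \<open>
  An ultrafilter is its set of member sets, so that \<open>p \<subseteq> \<F>\<close> is literal inclusion.
\<close>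

definition is_ultrafilter :: "nat set set \<Rightarrow> bool" where
  "is_ultrafilter p \<longleftrightarrow>
     p \<subseteq> Pow pos_nats \<and> pos_nats \<in> p \<and> {} \<notin> p \<and>
     (\<forall>A B. A \<in> p \<and> A \<subseteq> B \<and> B \<subseteq> pos_nats \<longrightarrow> B \<in> p) \<and>
     (\<forall>A B. A \<in> p \<and> B \<in> p \<longrightarrow> A \<inter> B \<in> p) \<and>
     (\<forall>A. A \<subseteq> pos_nats \<longrightarrow> A \<in> p \<or> pos_nats - A \<in> p)"

definition betaN :: "nat set set set" where
  "betaN = {p. is_ultrafilter p}"

definition beta_add :: "nat set set \<Rightarrow> nat set set \<Rightarrow> nat set set" where
  "beta_add p q = {A. A \<subseteq> pos_nats \<and> {n \<in> pos_nats. neg_shift n A \<in> q} \<in> p}"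

definition beta_family :: "nat set set \<Rightarrow> nat set set set" where
  "beta_family \<F> = {p \<in> betaN. p \<subseteq> \<F>}"

text \<open>
  Non-emptiness of a subsemigroup is not demanded here: for \<open>beta_family \<F>\<close> it follows
  from the Ramsey property, and also from the existence of an \<open>\<F>\<close>-minimal sequence.
\<close>

definition subsemigroup_betaN :: "nat set set set \<Rightarrow> bool" where
  "subsemigroup_betaN S \<longleftrightarrow> S \<subseteq> betaN \<and> (\<forall>p\<in>S. \<forall>q\<in>S. beta_add p q \<in> S)"

definition essential_star_set :: "nat set set \<Rightarrow> nat set \<Rightarrow> bool" where
  "essential_star_set \<F> A \<longleftrightarrow>
     A \<subseteq> pos_nats \<and> (\<forall>p\<in>beta_family \<F>. beta_add p p = p \<longrightarrow> A \<in> p)"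

definition cl_beta :: "nat set \<Rightarrow> nat set set set" where
  "cl_beta B = {p \<in> betaN. B \<in> p}"

text \<open>
  Sequences are indexed from 1: the value at index 0 is irrelevant, because every \<open>m\<close>
  below is at least 1 and every index set is a subset of \<open>pos_nats\<close>.
\<close>

definition pos_sequence :: "(nat \<Rightarrow> nat) \<Rightarrow> bool" where
  "pos_sequence x \<longleftrightarrow> (\<forall>n\<in>pos_nats. x n \<in> pos_nats)"

definition FS :: "(nat \<Rightarrow> nat) \<Rightarrow> nat \<Rightarrow> nat set" where
  "FS x m = {(\<Sum>n\<in>H. x n) |H. finite H \<and> H \<noteq> {} \<and> H \<subseteq> {m..}}"

definition FP :: "(nat \<Rightarrow> nat) \<Rightarrow> nat \<Rightarrow> nat set" where
  "FP x m = {(\<Prod>n\<in>H. x n) |H. finite H \<and> H \<noteq> {} \<and> H \<subseteq> {m..}}"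

definition minimal_sequence :: "nat set set \<Rightarrow> (nat \<Rightarrow> nat) \<Rightarrow> bool" where
  "minimal_sequence \<F> x \<longleftrightarrow> (\<Inter>m\<in>pos_nats. cl_beta (FS x m)) \<inter> beta_family \<F> \<noteq> {}"

definition sum_subsystem :: "(nat \<Rightarrow> nat) \<Rightarrow> (nat \<Rightarrow> nat) \<Rightarrow> bool" where
  "sum_subsystem y x \<longleftrightarrow>
     (\<exists>H. \<forall>n\<in>pos_nats.
        finite (H n) \<and> H n \<noteq> {} \<and> H n \<subseteq> pos_nats \<and>
        Max (H n) < Min (H (n + 1)) \<and> y n = (\<Sum>t\<in>H n. x t))"

end

theory Submission
  imports Defs
begin

text \<open>
  The ultrafilters in \<open>beta_family \<F>\<close> that contain every tail \<open>FS x m\<close> form a non-empty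
  compact subsemigroup, which has an idempotent \<open>p\<close> by Ellis' theorem. For every \<open>e\<close> in
  \<open>pos_nats\<close> the dilate \<open>e \<cdot> p\<close> is again an idempotent of \<open>beta_family \<F>\<close>, so the essential
  star set \<open>A\<close> lies in it, that is, \<open>{z. e * z \<in> A} \<in> p\<close>. Hence, as in the proof of
  Hindman's theorem, the terms \<open>y n\<close> can be chosen one after the other in sets of \<open>p\<close> so that
  all sums and all products of the terms chosen so far stay in \<open>A\<close>.
\<close>

section \<open>Ultrafilters\<close>

lemma
  assumes "is_ultrafilter p"
  shows ultrafilter_subset: "A \<in> p \<Longrightarrow> A \<subseteq> pos_nats"
    and ultrafilter_mono: "A \<in> p \<Longrightarrow> A \<subseteq> B \<Longrightarrow> B \<subseteq> pos_nats \<Longrightarrow> B \<in> p"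
    and ultrafilter_Int: "A \<in> p \<Longrightarrow> B \<in> p \<Longrightarrow> A \<inter> B \<in> p"
    and ultrafilter_nonempty: "A \<in> p \<Longrightarrow> A \<noteq> {}"
    and ultrafilter_pos_nats: "pos_nats \<in> p"
    and ultrafilter_cases: "A \<subseteq> pos_nats \<Longrightarrow> A \<in> p \<or> pos_nats - A \<in> p"
proof -
  note def = assms[unfolded is_ultrafilter_def]
  from def have "p \<subseteq> Pow pos_nats" by (elim conjE)
  then show "A \<in> p \<Longrightarrow> A \<subseteq> pos_nats" by blast
  from def have "\<forall>A B. A \<in> p \<and> A \<subseteq> B \<and> B \<subseteq> pos_nats \<longrightarrow> B \<in> p" by (elim conjE)
  then show "A \<in> p \<Longrightarrow> A \<subseteq> B \<Longrightarrow> B \<subseteq> pos_nats \<Longrightarrow> B \<in> p" by (elim allE impE) simp_all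
  from def have "\<forall>A B. A \<in> p \<and> B \<in> p \<longrightarrow> A \<inter> B \<in> p" by (elim conjE)
  then show "A \<in> p \<Longrightarrow> B \<in> p \<Longrightarrow> A \<inter> B \<in> p" by simp
  from def have "{} \<notin> p" by (elim conjE)
  then show "A \<in> p \<Longrightarrow> A \<noteq> {}" by auto
  from def show "pos_nats \<in> p" by (elim conjE)
  from def have "\<forall>A. A \<subseteq> pos_nats \<longrightarrow> A \<in> p \<or> pos_nats - A \<in> p" by (elim conjE)
  then show "A \<subseteq> pos_nats \<Longrightarrow> A \<in> p \<or> pos_nats - A \<in> p" by simp
qed

lemma ultrafilterI:
  assumes "p \<subseteq> Pow pos_nats" "pos_nats \<in> p" "{} \<notin> p"
    and "\<And>A B. A \<in> p \<Longrightarrow> A \<subseteq> B \<Longrightarrow> B \<subseteq> pos_nats \<Longrightarrow> B \<in> p"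
    and "\<And>A B. A \<in> p \<Longrightarrow> B \<in> p \<Longrightarrow> A \<inter> B \<in> p"
    and "\<And>A. A \<subseteq> pos_nats \<Longrightarrow> A \<in> p \<or> pos_nats - A \<in> p"
  shows "is_ultrafilter p"
  unfolding is_ultrafilter_def
  by (intro conjI allI impI; (elim conjE)?) (fact assms)+

lemma ultrafilter_Compl_iff:
  assumes "is_ultrafilter p" "A \<subseteq> pos_nats"
  shows "pos_nats - A \<in> p \<longleftrightarrow> A \<notin> p"
proof -
  have "A \<inter> (pos_nats - A) = {}" by simp
  then show ?thesis
    using ultrafilter_cases[OF assms] ultrafilter_Int[OF assms(1)] ultrafilter_nonempty[OF assms(1)]
    by metis
qed

text \<open>Writing the intersection as a comprehension keeps it inside \<open>pos_nats\<close> when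
  \<open>I\<close> is empty, which starts the induction.\<close>

lemma ultrafilter_INT:
  assumes "is_ultrafilter p" "finite I" "\<And>i. i \<in> I \<Longrightarrow> B i \<in> p"
  shows "{z \<in> pos_nats. \<forall>i\<in>I. z \<in> B i} \<in> p"
  using assms(2,3)
proof (induction I)
  case empty
  have "{z \<in> pos_nats. \<forall>i\<in>{}. z \<in> B i} = pos_nats" by blast
  then show ?case using ultrafilter_pos_nats[OF assms(1)] by metis
next
  case (insert i I)
  have "{z \<in> pos_nats. \<forall>i\<in>insert i I. z \<in> B i} = B i \<inter> {z \<in> pos_nats. \<forall>i\<in>I. z \<in> B i}"
    using insert.prems[of i] ultrafilter_subset[OF assms(1)] by auto
  then show ?case using insert ultrafilter_Int[OF assms(1)] by simp
qed

text \<open>Ultrafilters are maximal: if \<open>A\<close> were in \<open>q\<close> but not in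
  \<open>p\<close>, its complement would be in \<open>p\<close> and hence in
  \<open>q\<close>.\<close>

lemma ultrafilter_eqI:
  assumes "is_ultrafilter p" "is_ultrafilter q" "p \<subseteq> q"
  shows "p = q"
proof
  show "q \<subseteq> p"
  proof
    fix A assume "A \<in> q"
    then show "A \<in> p"
      using assms ultrafilter_Compl_iff ultrafilter_subset by blast
  qed
qed (fact assms(3))

text \<open>Zorn's lemma is applied to set systems closed under intersection, not to filters. Upward
  closure and the dichotomy are then derived from maximality.\<close>

lemma ultrafilter_extension:
  assumes "G \<subseteq> Pow pos_nats" "{} \<notin> G"
    and Int: "\<And>A B. A \<in> G \<Longrightarrow> B \<in> G \<Longrightarrow> A \<inter> B \<in> G"
  obtains p where "is_ultrafilter p" "G \<subseteq> p"
proof -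
  define Z where "Z = {P. G \<subseteq> P \<and> pos_nats \<in> P \<and> P \<subseteq> Pow pos_nats \<and> {} \<notin> P \<and>
    (\<forall>A\<in>P. \<forall>B\<in>P. A \<inter> B \<in> P)}"
  have ZD: "G \<subseteq> P" "pos_nats \<in> P" "P \<subseteq> Pow pos_nats" "{} \<notin> P"
      "\<And>A B. A \<in> P \<Longrightarrow> B \<in> P \<Longrightarrow> A \<inter> B \<in> P" if "P \<in> Z" for P
    using that unfolding Z_def by simp_all
  have ZI: "P \<in> Z" if "G \<subseteq> P" "pos_nats \<in> P" "P \<subseteq> Pow pos_nats" "{} \<notin> P"
      "\<And>A B. A \<in> P \<Longrightarrow> B \<in> P \<Longrightarrow> A \<inter> B \<in> P" for P
    using that unfolding Z_def by simp
  have "\<exists>M\<in>Z. \<forall>X\<in>Z. M \<subseteq> X \<longrightarrow> X = M"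
  proof (rule subset_Zorn_nonempty)
    have "A \<inter> pos_nats = A" "pos_nats \<inter> A = A" if "A \<in> G" for A
      using subsetD[OF assms(1) that] by (simp_all add: Int_absorb1 Int_absorb2)
    then have "A \<inter> B \<in> insert pos_nats G" if "A \<in> insert pos_nats G" "B \<in> insert pos_nats G" for A B
      using that Int by (elim insertE) simp_all
    then have "insert pos_nats G \<in> Z"
      using assms(1,2) by (intro ZI) (auto)
    then show "Z \<noteq> {}" by blast
  next
    fix C assume C: "C \<noteq> {}" "subset.chain Z C"
    then have CZ: "C \<subseteq> Z" unfolding subset_chain_def by blast
    have "A \<inter> B \<in> \<Union>C" if AB: "A \<in> \<Union>C" "B \<in> \<Union>C" for A B
    proof -
      obtain P Q where PQ: "P \<in> C" "A \<in> P" "Q \<in> C" "B \<in> Q" using AB by blast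
      have "P \<subseteq> Q \<or> Q \<subseteq> P" using C(2) PQ(1,3) unfolding subset_chain_def by blast
      then obtain R where "R \<in> C" "A \<in> R" "B \<in> R" using PQ by blast
      then show ?thesis using CZ ZD(5)[of R A B] by blast
    qed
    moreover obtain P where "P \<in> C" using C(1) by blast
    then have "G \<subseteq> \<Union>C" "pos_nats \<in> \<Union>C" using CZ ZD(1,2)[of P] by blast+
    moreover have "\<Union>C \<subseteq> Pow pos_nats" using CZ ZD(3) by (intro Sup_least) auto
    moreover have "{} \<notin> \<Union>C" using CZ ZD(4) by auto
    ultimately show "\<Union>C \<in> Z" by (intro ZI)
  qed
  then obtain M where M: "M \<in> Z" "\<And>X. X \<in> Z \<Longrightarrow> M \<subseteq> X \<Longrightarrow> X = M" by blast
  note GM = ZD(1)[OF M(1)] and pos = ZD(2)[OF M(1)] and sub = ZD(3)[OF M(1)]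
    and ne = ZD(4)[OF M(1)] and M_Int = ZD(5)[OF M(1)]
  \<comment> \<open>Adjoining \<open>X\<close> and its traces on \<open>M\<close> creates no empty
    set, so the enlarged system is still in \<open>Z\<close> and maximality absorbs it.\<close>
  have max: "X \<in> M" if X: "X \<subseteq> pos_nats" "\<And>B. B \<in> M \<Longrightarrow> X \<inter> B \<noteq> {}" for X
  proof -
    let ?M = "M \<union> (\<inter>) X ` M"
    have "A \<inter> B \<in> ?M" if AB: "A \<in> ?M" "B \<in> ?M" for A B
    proof -
      obtain A' B' where *: "A' \<in> M" "A = A' \<or> A = X \<inter> A'" "B' \<in> M" "B = B' \<or> B = X \<inter> B'"
        using AB by blast
      then have "A \<inter> B = A' \<inter> B' \<or> A \<inter> B = X \<inter> (A' \<inter> B')" by auto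
      then show ?thesis using M_Int[OF *(1,3)] by auto
    qed
    moreover have "{} \<notin> ?M" using ne X(2) by fastforce
    moreover have "?M \<subseteq> Pow pos_nats" using sub by blast
    ultimately have "?M \<in> Z" using GM pos by (intro ZI) auto
    then have "?M = M" using M(2) by blast
    moreover have "X = X \<inter> pos_nats" using X(1) by blast
    ultimately show ?thesis using pos by blast
  qed
  have mono: "B \<in> M" if AB: "A \<in> M" "A \<subseteq> B" "B \<subseteq> pos_nats" for A B
  proof (rule max)
    fix C assume "C \<in> M"
    then have "A \<inter> C \<noteq> {}" using M_Int[OF AB(1)] ne by metis
    then show "B \<inter> C \<noteq> {}" using AB(2) by blast
  qed (fact AB(3))
  have dichotomy: "A \<in> M \<or> pos_nats - A \<in> M" if A: "A \<subseteq> pos_nats" for A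
  proof (rule disjCI)
    assume notin: "pos_nats - A \<notin> M"
    show "A \<in> M"
    proof (rule max[OF A])
      fix B assume B: "B \<in> M"
      show "A \<inter> B \<noteq> {}"
      proof
        assume "A \<inter> B = {}"
        then have "B \<subseteq> pos_nats - A" using B sub by blast
        then show False using mono[OF B] notin by blast
      qed
    qed
  qed
  have "is_ultrafilter M"
    by (rule ultrafilterI) (fact sub pos ne mono M_Int dichotomy)+
  then show ?thesis using that GM by blast
qed

section \<open>Compactness and idempotents\<close>

text \<open>
  An ultrafilter \<open>r\<close> is in the closure of \<open>S\<close> iff every member of \<open>r\<close> is a member of
  some \<open>q \<in> S\<close>.
\<close>

definition beta_closed :: "nat set set set \<Rightarrow> bool" where
  "beta_closed S \<longleftrightarrow> S \<subseteq> betaN \<and> (\<forall>r\<in>betaN. r \<subseteq> \<Union>S \<longrightarrow> r \<in> S)"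

lemma beta_closed_ultrafilter: "beta_closed S \<Longrightarrow> p \<in> S \<Longrightarrow> is_ultrafilter p"
  unfolding beta_closed_def betaN_def by blast

text \<open>This is the dual form of closedness, obtained by complementation: a closed set is
  determined by the sets common to all its ultrafilters.\<close>

lemma beta_closed_memI:
  assumes "beta_closed S" "is_ultrafilter r"
    and "\<And>A. A \<subseteq> pos_nats \<Longrightarrow> \<forall>q\<in>S. A \<in> q \<Longrightarrow> A \<in> r"
  shows "r \<in> S"
proof -
  have "r \<subseteq> \<Union>S"
  proof
    fix A assume A: "A \<in> r"
    then have sub: "A \<subseteq> pos_nats" using assms(2) ultrafilter_subset by blast
    show "A \<in> \<Union>S"
    proof (rule ccontr)
      assume "A \<notin> \<Union>S"
      then have "\<forall>q\<in>S. pos_nats - A \<in> q"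
        using ultrafilter_Compl_iff beta_closed_ultrafilter[OF assms(1)] sub by blast
      then have "pos_nats - A \<in> r" by (intro assms(3)) auto
      then show False using A ultrafilter_Compl_iff[OF assms(2) sub] by blast
    qed
  qed
  then show ?thesis using assms(1,2) unfolding beta_closed_def betaN_def by blast
qed

text \<open>This is compactness of closed sets in the form used below. The system \<open>G\<close>
  is enlarged by all sets common to the ultrafilters in \<open>S\<close>; any ultrafilter extending
  the result is forced into \<open>S\<close>.\<close>

lemma beta_closed_compact:
  assumes S: "beta_closed S" and G: "G \<noteq> {}"
    and GInt: "\<And>A B. A \<in> G \<Longrightarrow> B \<in> G \<Longrightarrow> A \<inter> B \<in> G"
    and meet: "\<And>A. A \<in> G \<Longrightarrow> \<exists>q\<in>S. A \<in> q"
  obtains q where "q \<in> S" "G \<subseteq> q"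
proof -
  define K where "K = {A \<inter> B |A B. A \<in> G \<and> B \<subseteq> pos_nats \<and> (\<forall>q\<in>S. B \<in> q)}"
  note uf = beta_closed_ultrafilter[OF S]
  have Gsub: "A \<subseteq> pos_nats" if "A \<in> G" for A using meet[OF that] uf ultrafilter_subset by blast
  have all: "\<forall>q\<in>S. pos_nats \<in> q" using uf ultrafilter_pos_nats by blast
  obtain p where p: "is_ultrafilter p" "K \<subseteq> p"
  proof (rule ultrafilter_extension[of K])
    show "K \<subseteq> Pow pos_nats" using Gsub unfolding K_def by blast
    show "{} \<notin> K"
    proof
      assume "{} \<in> K"
      then obtain A B where "{} = A \<inter> B" "A \<in> G" "\<forall>q\<in>S. B \<in> q" unfolding K_def by blast
      moreover obtain q where "q \<in> S" "A \<in> q" using meet \<open>A \<in> G\<close> by blast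
      ultimately show False using ultrafilter_Int ultrafilter_nonempty uf by metis
    qed
    fix X Y assume "X \<in> K" "Y \<in> K"
    then obtain A B A' B' where *: "X = A \<inter> B" "A \<in> G" "B \<subseteq> pos_nats" "\<forall>q\<in>S. B \<in> q"
      "Y = A' \<inter> B'" "A' \<in> G" "B' \<subseteq> pos_nats" "\<forall>q\<in>S. B' \<in> q" unfolding K_def by blast
    then have "X \<inter> Y = (A \<inter> A') \<inter> (B \<inter> B')" "A \<inter> A' \<in> G" "B \<inter> B' \<subseteq> pos_nats"
      "\<forall>q\<in>S. B \<inter> B' \<in> q" using GInt ultrafilter_Int uf by auto
    then show "X \<inter> Y \<in> K" unfolding K_def by blast
  qed
  have "G \<subseteq> p"
  proof
    fix A assume "A \<in> G"
    then have "A \<inter> pos_nats \<in> K" using all unfolding K_def by blast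
    then show "A \<in> p" using p Gsub[OF \<open>A \<in> G\<close>] by (metis Int_absorb2 subsetD)
  qed
  moreover have "p \<in> S"
  proof (rule beta_closed_memI[OF S p(1)])
    fix B assume B: "B \<subseteq> pos_nats" "\<forall>q\<in>S. B \<in> q"
    obtain A where "A \<in> G" using G by blast
    then have "A \<inter> B \<in> p" using B p(2) unfolding K_def by blast
    then show "B \<in> p" using ultrafilter_mono[OF p(1)] B(1) by blast
  qed
  ultimately show ?thesis using that by blast
qed

lemma beta_closed_Inter:
  assumes "C \<noteq> {}" "\<And>S. S \<in> C \<Longrightarrow> beta_closed S"
  shows "beta_closed (\<Inter>C)"
  unfolding beta_closed_def
proof (intro conjI ballI impI)
  show "\<Inter>C \<subseteq> betaN" using assms unfolding beta_closed_def by blast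
  fix r assume r: "r \<in> betaN" "r \<subseteq> \<Union>(\<Inter>C)"
  show "r \<in> \<Inter>C"
  proof
    fix S assume S: "S \<in> C"
    then have "r \<subseteq> \<Union>S" using r(2) by blast
    then show "r \<in> S" using assms(2)[OF S] r(1) unfolding beta_closed_def by blast
  qed
qed

lemma beta_closed_cl_beta:
  assumes "B \<subseteq> pos_nats"
  shows "beta_closed (cl_beta B)"
  unfolding beta_closed_def
proof (intro conjI ballI impI)
  show "cl_beta B \<subseteq> betaN" unfolding cl_beta_def by blast
  fix r assume r: "r \<in> betaN" "r \<subseteq> \<Union>(cl_beta B)"
  then have "pos_nats - B \<notin> r"
    using ultrafilter_Compl_iff[OF _ assms] unfolding cl_beta_def betaN_def by blast
  then show "r \<in> cl_beta B"
    using r(1) ultrafilter_Compl_iff[OF _ assms] unfolding cl_beta_def betaN_def by blast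
qed

text \<open>A union of ultrafilters that are subsets of \<open>\<F>\<close> is itself a subset of
  \<open>\<F>\<close>, and so is every ultrafilter below that union.\<close>

lemma beta_closed_beta_family: "beta_closed (beta_family \<F>)"
  unfolding beta_closed_def beta_family_def by blast

section \<open>Addition of ultrafilters\<close>

lemma neg_shift_subset: "neg_shift n A \<subseteq> pos_nats"
  unfolding neg_shift_def by blast

lemma neg_shift_Int: "neg_shift n (A \<inter> B) = neg_shift n A \<inter> neg_shift n B"
  unfolding neg_shift_def by auto

lemma neg_shift_neg_shift: "neg_shift n (neg_shift m A) = neg_shift (m + n) A"
  unfolding neg_shift_def by (auto simp: add.assoc)

lemma mem_beta_add:
  "A \<in> beta_add p q \<longleftrightarrow> A \<subseteq> pos_nats \<and> {n \<in> pos_nats. neg_shift n A \<in> q} \<in> p"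
  unfolding beta_add_def by blast

lemma ultrafilter_beta_add:
  assumes p: "is_ultrafilter p" and q: "is_ultrafilter q"
  shows "is_ultrafilter (beta_add p q)"
proof (rule ultrafilterI)
  show "beta_add p q \<subseteq> Pow pos_nats" using mem_beta_add by auto
  have "neg_shift n pos_nats = pos_nats" for n unfolding neg_shift_def by auto
  then have "{n \<in> pos_nats. neg_shift n pos_nats \<in> q} = pos_nats"
    using ultrafilter_pos_nats[OF q] by auto
  then show "pos_nats \<in> beta_add p q"
    using ultrafilter_pos_nats[OF p] by (simp only: mem_beta_add subset_refl simp_thms)
  have "neg_shift n {} = {}" for n unfolding neg_shift_def by auto
  then have "{n \<in> pos_nats. neg_shift n {} \<in> q} = {}" using ultrafilter_nonempty[OF q] by auto
  then show "{} \<notin> beta_add p q"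
    using ultrafilter_nonempty[OF p] by (auto simp only: mem_beta_add)
next
  fix A B assume A: "A \<in> beta_add p q" and AB: "A \<subseteq> B" and B: "B \<subseteq> pos_nats"
  have "neg_shift n A \<subseteq> neg_shift n B" for n using AB unfolding neg_shift_def by auto
  then have "neg_shift n B \<in> q" if "neg_shift n A \<in> q" for n
    using ultrafilter_mono[OF q that] neg_shift_subset by simp
  then have sub: "{n \<in> pos_nats. neg_shift n A \<in> q} \<subseteq> {n \<in> pos_nats. neg_shift n B \<in> q}" by auto
  have "{n \<in> pos_nats. neg_shift n A \<in> q} \<in> p" using A unfolding mem_beta_add by blast
  then have "{n \<in> pos_nats. neg_shift n B \<in> q} \<in> p" by (rule ultrafilter_mono[OF p _ sub]) auto
  then show "B \<in> beta_add p q" using B unfolding mem_beta_add by simp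
next
  fix A B assume A: "A \<in> beta_add p q" and B: "B \<in> beta_add p q"
  have "neg_shift n (A \<inter> B) \<in> q" if "neg_shift n A \<in> q" "neg_shift n B \<in> q" for n
    using ultrafilter_Int[OF q that] neg_shift_Int by metis
  then have sub: "{n \<in> pos_nats. neg_shift n A \<in> q} \<inter> {n \<in> pos_nats. neg_shift n B \<in> q}
      \<subseteq> {n \<in> pos_nats. neg_shift n (A \<inter> B) \<in> q}" by auto
  have "{n \<in> pos_nats. neg_shift n A \<in> q} \<inter> {n \<in> pos_nats. neg_shift n B \<in> q} \<in> p"
    using A B unfolding mem_beta_add by (blast intro: ultrafilter_Int[OF p])
  then have "{n \<in> pos_nats. neg_shift n (A \<inter> B) \<in> q} \<in> p"
    by (rule ultrafilter_mono[OF p _ sub]) auto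
  then show "A \<inter> B \<in> beta_add p q" using A unfolding mem_beta_add by auto
next
  fix A :: "nat set" assume A: "A \<subseteq> pos_nats"
  let ?N = "{n \<in> pos_nats. neg_shift n A \<in> q}"
  have "neg_shift n (pos_nats - A) = pos_nats - neg_shift n A" for n unfolding neg_shift_def by auto
  then have *: "{n \<in> pos_nats. neg_shift n (pos_nats - A) \<in> q} = pos_nats - ?N"
    using ultrafilter_Compl_iff[OF q neg_shift_subset] by auto
  have "?N \<in> p \<or> pos_nats - ?N \<in> p" by (rule ultrafilter_cases[OF p]) auto
  then show "A \<in> beta_add p q \<or> pos_nats - A \<in> beta_add p q"
    using A unfolding mem_beta_add * by simp
qed

lemma beta_add_assoc: "beta_add (beta_add p q) r = beta_add p (beta_add q r)"
proof -
  have "neg_shift m {n \<in> pos_nats. neg_shift n A \<in> r}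
      = {n \<in> pos_nats. neg_shift n (neg_shift m A) \<in> r}" for m A
    unfolding neg_shift_neg_shift by (auto simp: neg_shift_def)
  moreover have "{n \<in> pos_nats. neg_shift n A \<in> r} \<subseteq> pos_nats" for A by auto
  ultimately show ?thesis
    by (intro set_eqI) (simp only: mem_beta_add neg_shift_subset simp_thms)
qed

section \<open>Right translations and Ellis' theorem\<close>

text \<open>The map \<open>q\<close> to \<open>beta_add q p\<close> is continuous, so the image of a
  compact set is closed. Concretely, for \<open>r\<close> in the closure of the image, compactness
  yields one \<open>q\<close> that works for all members of \<open>r\<close> at once.\<close>

lemma beta_closed_right_translate:
  assumes S: "beta_closed S" and p: "is_ultrafilter p"
  shows "beta_closed ((\<lambda>q. beta_add q p) ` S)"
  unfolding beta_closed_def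
proof (intro conjI ballI impI)
  show "(\<lambda>q. beta_add q p) ` S \<subseteq> betaN"
    using ultrafilter_beta_add beta_closed_ultrafilter[OF S] p unfolding betaN_def by blast
  fix r assume r: "r \<in> betaN" "r \<subseteq> \<Union>((\<lambda>q. beta_add q p) ` S)"
  \<comment> \<open>For \<open>A\<close> within \<open>pos_nats\<close>, \<open>A\<close> is in
    \<open>beta_add q p\<close> exactly if \<open>P A\<close> is in \<open>q\<close>. So
    \<open>q\<close> is sought as an ultrafilter in \<open>S\<close> containing \<open>P A\<close>
    for all \<open>A\<close> in \<open>r\<close>.\<close>
  define P where "P A = {n \<in> pos_nats. neg_shift n A \<in> p}" for A
  have P_Int: "P A \<inter> P B = P (A \<inter> B)" for A B
  proof -
    have "neg_shift n (A \<inter> B) \<in> p \<longleftrightarrow> neg_shift n A \<in> p \<and> neg_shift n B \<in> p" for n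
      using ultrafilter_Int[OF p] ultrafilter_mono[OF p] neg_shift_subset
      unfolding neg_shift_Int by (metis inf_le1 inf_le2)
    then show ?thesis unfolding P_def by blast
  qed
  have rU: "is_ultrafilter r" using r(1) unfolding betaN_def by blast
  obtain q where q: "q \<in> S" "P ` r \<subseteq> q"
  proof (rule beta_closed_compact[OF S, of "P ` r"])
    show "P ` r \<noteq> {}" using ultrafilter_pos_nats[OF rU] by blast
    show "X \<inter> Y \<in> P ` r" if "X \<in> P ` r" "Y \<in> P ` r" for X Y
      using that P_Int ultrafilter_Int[OF rU] by auto
    show "\<exists>q\<in>S. X \<in> q" if X: "X \<in> P ` r" for X
    proof -
      obtain A where A: "A \<in> r" "X = P A" using X by blast
      then obtain q where "q \<in> S" "A \<in> beta_add q p" using r(2) by blast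
      then show ?thesis using A(2) unfolding mem_beta_add P_def by blast
    qed
  qed
  have "r \<subseteq> beta_add q p"
  proof
    fix A assume A: "A \<in> r"
    then have "P A \<in> q" using q(2) by blast
    then show "A \<in> beta_add q p"
      using ultrafilter_subset[OF rU A] unfolding mem_beta_add P_def by simp
  qed
  then have "r = beta_add q p"
    using rU ultrafilter_eqI ultrafilter_beta_add beta_closed_ultrafilter[OF S q(1)] p by blast
  then show "r \<in> (\<lambda>q. beta_add q p) ` S" using q(1) by blast
qed

text \<open>The set is the preimage of the point \<open>p\<close> under a continuous map.\<close>

lemma beta_closed_right_stabilizer:
  assumes S: "beta_closed S" and p: "is_ultrafilter p"
  shows "beta_closed {q \<in> S. beta_add q p = p}" (is "beta_closed ?T")
  unfolding beta_closed_def
proof (intro conjI ballI impI)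
  show "?T \<subseteq> betaN" using S unfolding beta_closed_def by auto
  fix r assume r: "r \<in> betaN" "r \<subseteq> \<Union>?T"
  have rU: "is_ultrafilter r" using r(1) unfolding betaN_def by simp
  have "\<Union>?T \<subseteq> \<Union>S" by (rule Union_mono) simp
  then have "r \<subseteq> \<Union>S" using r(2) by (rule subset_trans[rotated])
  then have rS: "r \<in> S" using S r(1) unfolding beta_closed_def by simp
  have "p \<subseteq> beta_add r p"
  proof
    fix A assume A: "A \<in> p"
    let ?P = "{n \<in> pos_nats. neg_shift n A \<in> p}"
    have P: "?P \<subseteq> pos_nats" by auto
    have "?P \<in> r"
    \<comment> \<open>The complement of \<open>?P\<close> would be in \<open>r\<close>, hence in
      some \<open>q\<close> of the stabilizer, although \<open>A\<close> in
      \<open>p = beta_add q p\<close> puts \<open>?P\<close> into that \<open>q\<close>.\<close>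
    proof (rule ccontr)
      assume "?P \<notin> r"
      then have "pos_nats - ?P \<in> r" using ultrafilter_Compl_iff[OF rU P] by simp
      then have "pos_nats - ?P \<in> \<Union>?T" by (rule subsetD[OF r(2)])
      then obtain q where q: "q \<in> S" "beta_add q p = p" "pos_nats - ?P \<in> q" by blast
      have "A \<in> beta_add q p" using A q(2) by simp
      then have "?P \<in> q" unfolding mem_beta_add by (rule conjunct2)
      then show False
        using q(3) ultrafilter_Compl_iff[OF beta_closed_ultrafilter[OF S q(1)] P] by simp
    qed
    then show "A \<in> beta_add r p"
      unfolding mem_beta_add by (intro conjI ultrafilter_subset[OF p A])
  qed
  then have "p = beta_add r p" by (rule ultrafilter_eqI[OF p ultrafilter_beta_add[OF rU p]])
  then show "r \<in> ?T" using rS by simp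
qed

text \<open>By compactness, nested non-empty closed sets have a common point. It is found inside one
  fixed member \<open>T0\<close> of the chain.\<close>

lemma beta_closed_chain_Inter_nonempty:
  assumes C: "C \<noteq> {}" and cl: "\<And>T. T \<in> C \<Longrightarrow> beta_closed T" and ne: "\<And>T. T \<in> C \<Longrightarrow> T \<noteq> {}"
    and lin: "\<And>T U. T \<in> C \<Longrightarrow> U \<in> C \<Longrightarrow> T \<subseteq> U \<or> U \<subseteq> T"
  shows "\<Inter>C \<noteq> {}"
proof -
  obtain T0 where T0: "T0 \<in> C" using C by auto
  \<comment> \<open>An ultrafilter containing \<open>G\<close> has all sets common to any one chain
    member, so it lies in every chain member. Linearity of the chain makes \<open>G\<close> closed
    under intersection.\<close>
  define G where "G = {A. A \<subseteq> pos_nats \<and> (\<exists>T\<in>C. \<forall>q\<in>T. A \<in> q)}"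
  note uf = beta_closed_ultrafilter[OF cl]
  have GI: "A \<in> G" if "A \<subseteq> pos_nats" "T \<in> C" "\<And>q. q \<in> T \<Longrightarrow> A \<in> q" for A T
    using that unfolding G_def by auto
  obtain r where r: "r \<in> T0" "G \<subseteq> r"
  proof (rule beta_closed_compact[OF cl[OF T0], of G])
    have "pos_nats \<in> G" by (rule GI[OF subset_refl T0]) (rule ultrafilter_pos_nats[OF uf[OF T0]])
    then show "G \<noteq> {}" by auto
  next
    fix A B assume "A \<in> G" "B \<in> G"
    then obtain T U where *: "A \<subseteq> pos_nats" "T \<in> C" "\<forall>q\<in>T. A \<in> q" "U \<in> C" "\<forall>q\<in>U. B \<in> q"
      unfolding G_def by auto
    obtain V where V: "V \<in> C" "V \<subseteq> T" "V \<subseteq> U" using lin[OF *(2,4)] *(2,4) by auto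
    show "A \<inter> B \<in> G"
    proof (rule GI[OF _ V(1)])
      fix q assume q: "q \<in> V"
      show "A \<inter> B \<in> q" using q V *(3,5) by (intro ultrafilter_Int[OF uf[OF V(1) q]]) auto
    qed (use *(1) in auto)
  next
    fix A assume "A \<in> G"
    then obtain T where T: "T \<in> C" "\<forall>q\<in>T. A \<in> q" unfolding G_def by auto
    have "T \<inter> T0 \<noteq> {}" using lin[OF T(1) T0] ne[OF T(1)] ne[OF T0] by auto
    then show "\<exists>q\<in>T0. A \<in> q" using T(2) by auto
  qed
  have "r \<in> T" if T: "T \<in> C" for T
  proof (rule beta_closed_memI[OF cl[OF T] uf[OF T0 r(1)]])
    fix A :: "nat set" assume "A \<subseteq> pos_nats" "\<forall>q\<in>T. A \<in> q"
    then have "A \<in> G" by (intro GI[OF _ T]) auto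
    then show "A \<in> r" using r(2) by auto
  qed
  then show ?thesis by auto
qed

text \<open>This is Ellis' argument: in a minimal closed subsemigroup \<open>M\<close>, every
  element \<open>p\<close> is idempotent. Minimality is used twice, first for the translate of
  \<open>M\<close> by \<open>p\<close> and then for the stabilizer of \<open>p\<close> in
  \<open>M\<close>.\<close>

theorem idempotent_in_beta_closed_subsemigroup:
  assumes "beta_closed S" "S \<noteq> {}" "subsemigroup_betaN S"
  obtains p where "p \<in> S" "beta_add p p = p"
proof -
  define Z where "Z = {T. T \<subseteq> S \<and> T \<noteq> {} \<and> beta_closed T \<and> (\<forall>p\<in>T. \<forall>q\<in>T. beta_add p q \<in> T)}"
  have ZI: "T \<in> Z" if "T \<subseteq> S" "T \<noteq> {}" "beta_closed T" "\<And>p q. p \<in> T \<Longrightarrow> q \<in> T \<Longrightarrow> beta_add p q \<in> T" for T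
    using that unfolding Z_def by simp
  have ZD: "T \<subseteq> S" "T \<noteq> {}" "beta_closed T" "\<And>p q. p \<in> T \<Longrightarrow> q \<in> T \<Longrightarrow> beta_add p q \<in> T"
    if "T \<in> Z" for T
    using that unfolding Z_def by simp_all
  have "S \<in> Z" using assms unfolding subsemigroup_betaN_def by (intro ZI) auto
  have "\<exists>M\<in>Z. \<forall>X\<in>Z. X \<subseteq> M \<longrightarrow> X = M"
  \<comment> \<open>The order is reversed inclusion, so upper bounds of chains are intersections;
    the empty chain is bounded by \<open>S\<close>.\<close>
  proof (rule predicate_Zorn[where P = "\<lambda>A B. B \<subseteq> A", simplified])
    show "partial_order_on Z (relation_of (\<lambda>A B. B \<subseteq> A) Z)"
      by (rule partial_order_on_relation_ofI) auto
    fix C assume C: "C \<in> Chains (relation_of (\<lambda>A B. B \<subseteq> A) Z)"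
    then have CZ: "\<And>T. T \<in> C \<Longrightarrow> T \<in> Z"
      and lin: "\<And>T U. T \<in> C \<Longrightarrow> U \<in> C \<Longrightarrow> T \<subseteq> U \<or> U \<subseteq> T"
      unfolding Chains_def relation_of_def by auto
    show "\<exists>U\<in>Z. \<forall>T\<in>C. U \<subseteq> T"
    proof (cases "C = {}")
      case True
      then show ?thesis using \<open>S \<in> Z\<close> by auto
    next
      case False
      have "\<Inter>C \<in> Z"
      proof (rule ZI)
        show "\<Inter>C \<subseteq> S" using False ZD(1)[OF CZ] by auto
        show "\<Inter>C \<noteq> {}"
          by (rule beta_closed_chain_Inter_nonempty[OF False ZD(3)[OF CZ] ZD(2)[OF CZ] lin])
        show "beta_closed (\<Inter>C)" by (rule beta_closed_Inter[OF False ZD(3)[OF CZ]])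
        show "beta_add p q \<in> \<Inter>C" if "p \<in> \<Inter>C" "q \<in> \<Inter>C" for p q
          using that ZD(4)[OF CZ] by simp
      qed
      then show ?thesis by auto
    qed
  qed
  then obtain M where MZ: "M \<in> Z" and min: "\<And>X. X \<in> Z \<Longrightarrow> X \<subseteq> M \<Longrightarrow> X = M" by auto
  note MS = ZD(1)[OF MZ] and Mcl = ZD(3)[OF MZ] and add = ZD(4)[OF MZ]
  obtain p where p: "p \<in> M" using ZD(2)[OF MZ] by auto
  note pU = beta_closed_ultrafilter[OF Mcl p]
  \<comment> \<open>Since \<open>?T\<close> is a closed subsemigroup inside \<open>M\<close>, it
    equals \<open>M\<close>; thus \<open>p\<close> itself is a translate, which makes the stabilizer
    \<open>?U\<close> below non-empty.\<close>
  let ?T = "(\<lambda>q. beta_add q p) ` M"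
  have TM: "?T \<subseteq> M" using add p by auto
  have "?T \<in> Z"
  proof (rule ZI[OF _ _ beta_closed_right_translate[OF Mcl pU]])
    show "?T \<subseteq> S" using TM MS by (rule subset_trans)
    show "?T \<noteq> {}" using p by auto
    fix a b assume "a \<in> ?T" "b \<in> ?T"
    then obtain c d where cd: "c \<in> M" "d \<in> M" "a = beta_add c p" "b = beta_add d p" by auto
    then have "beta_add a b = beta_add (beta_add c (beta_add p d)) p" by (simp add: beta_add_assoc)
    then show "beta_add a b \<in> ?T" using add[OF cd(1) add[OF p cd(2)]] by (rule image_eqI)
  qed
  then have "?T = M" by (rule min[OF _ TM])
  then have "p \<in> ?T" using p by simp
  then obtain q0 where q0: "q0 \<in> M" "beta_add q0 p = p" by auto
  \<comment> \<open>Once minimality gives \<open>?U = M\<close>, membership of \<open>p\<close> in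
    \<open>?U\<close> says that \<open>p\<close> is idempotent.\<close>
  let ?U = "{q \<in> M. beta_add q p = p}"
  have UM: "?U \<subseteq> M" by auto
  have "?U \<in> Z"
  proof (rule ZI[OF _ _ beta_closed_right_stabilizer[OF Mcl pU]])
    show "?U \<subseteq> S" using UM MS by (rule subset_trans)
    show "?U \<noteq> {}" using q0 by auto
    show "beta_add a b \<in> ?U" if "a \<in> ?U" "b \<in> ?U" for a b
      using that add by (simp add: beta_add_assoc)
  qed
  then have "?U = M" by (rule min[OF _ UM])
  then have "p \<in> ?U" using p by simp
  then show ?thesis using that p MS by auto
qed

section \<open>Tails of finite sums and dilations\<close>

lemma FS_subset_pos_nats:
  assumes "pos_sequence x" "m \<in> pos_nats"
  shows "FS x m \<subseteq> pos_nats"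
proof
  fix s assume "s \<in> FS x m"
  then obtain H where H: "s = sum x H" "finite H" "H \<noteq> {}" "H \<subseteq> {m..}" unfolding FS_def by blast
  have "0 < x n" if "n \<in> H" for n
  proof -
    have "m \<le> n" using H(4) that by auto
    then have "n \<in> pos_nats" using assms(2) by simp
    then show ?thesis using assms(1) unfolding pos_sequence_def by simp
  qed
  then show "s \<in> pos_nats" using H sum_pos[of H x] by simp
qed

text \<open>For each \<open>s\<close> in \<open>FS x m\<close>, adding a sum from a sufficiently
  late tail stays in \<open>FS x m\<close>. So \<open>neg_shift s (FS x m)\<close> contains a tail
  and is in \<open>q\<close>, and such \<open>s\<close> already fill a member of
  \<open>p\<close>.\<close>

lemma subsemigroup_FS_tails:
  assumes x: "pos_sequence x"
  shows "subsemigroup_betaN (\<Inter>m\<in>pos_nats. cl_beta (FS x m))" (is "subsemigroup_betaN ?T")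
  unfolding subsemigroup_betaN_def
proof (intro conjI ballI)
  show "?T \<subseteq> betaN" unfolding cl_beta_def by blast
  fix p q assume pq: "p \<in> ?T" "q \<in> ?T"
  then have p: "is_ultrafilter p" "\<And>m. m \<in> pos_nats \<Longrightarrow> FS x m \<in> p"
    and q: "is_ultrafilter q" "\<And>m. m \<in> pos_nats \<Longrightarrow> FS x m \<in> q"
    unfolding cl_beta_def betaN_def by auto
  have "FS x m \<in> beta_add p q" if m: "m \<in> pos_nats" for m
  proof -
    have "FS x m \<subseteq> {n \<in> pos_nats. neg_shift n (FS x m) \<in> q}"
    proof
      fix s assume s: "s \<in> FS x m"
      then obtain H where H: "s = sum x H" "finite H" "H \<noteq> {}" "H \<subseteq> {m..}" unfolding FS_def by blast
      \<comment> \<open>Beyond all of \<open>H\<close>, so that the two index sets are disjoint, and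
        at least \<open>m\<close>, so that their union stays in \<open>{m..}\<close>.\<close>
      define k where "k = m + Suc (Max H)"
      have k: "k \<in> pos_nats" unfolding k_def by simp
      have "FS x k \<subseteq> neg_shift s (FS x m)"
      proof
        fix t assume t: "t \<in> FS x k"
        then obtain K where K: "t = sum x K" "finite K" "K \<noteq> {}" "K \<subseteq> {k..}" unfolding FS_def by blast
        have "i < k" if "i \<in> H" for i
          using Max_ge[OF H(2) that] unfolding k_def by linarith
        then have "H \<inter> K = {}" using K(4) by fastforce
        then have "s + t = sum x (H \<union> K)" using H(1,2) K(1,2) by (simp add: sum.union_disjoint)
        moreover have "H \<union> K \<subseteq> {m..}" using H(4) K(4) unfolding k_def by force
        ultimately have "s + t \<in> FS x m" using H K unfolding FS_def by blast
        moreover have "t \<in> pos_nats" using t FS_subset_pos_nats[OF x k] by blast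
        ultimately show "t \<in> neg_shift s (FS x m)" unfolding neg_shift_def by blast
      qed
      then have "neg_shift s (FS x m) \<in> q"
        using ultrafilter_mono[OF q(1) q(2)[OF k]] neg_shift_subset by blast
      then show "s \<in> {n \<in> pos_nats. neg_shift n (FS x m) \<in> q}"
        using s FS_subset_pos_nats[OF x m] by blast
    qed
    then have "{n \<in> pos_nats. neg_shift n (FS x m) \<in> q} \<in> p"
      using ultrafilter_mono[OF p(1) p(2)[OF m]] by blast
    then show ?thesis using FS_subset_pos_nats[OF x m] unfolding mem_beta_add by blast
  qed
  moreover have "beta_add p q \<in> betaN" using ultrafilter_beta_add p(1) q(1) unfolding betaN_def by blast
  ultimately show "beta_add p q \<in> ?T" unfolding cl_beta_def by blast
qed

section \<open>Dilates of ultrafilters\<close>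

definition inv_dilate :: "nat \<Rightarrow> nat set \<Rightarrow> nat set" where
  "inv_dilate e A = {z \<in> pos_nats. e * z \<in> A}"

lemma inv_dilate_subset: "inv_dilate e A \<subseteq> pos_nats"
  unfolding inv_dilate_def by blast

text \<open>This is the image ultrafilter of \<open>p\<close> under multiplication by
  \<open>e\<close>.\<close>

definition beta_dilate :: "nat \<Rightarrow> nat set set \<Rightarrow> nat set set" where
  "beta_dilate e p = {A. A \<subseteq> pos_nats \<and> inv_dilate e A \<in> p}"

lemma ultrafilter_beta_dilate:
  assumes p: "is_ultrafilter p" and e: "e \<in> pos_nats"
  shows "is_ultrafilter (beta_dilate e p)"
proof (rule ultrafilterI)
  show "beta_dilate e p \<subseteq> Pow pos_nats" unfolding beta_dilate_def by auto
  have "inv_dilate e pos_nats = pos_nats" using e unfolding inv_dilate_def by auto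
  then show "pos_nats \<in> beta_dilate e p"
    using ultrafilter_pos_nats[OF p] unfolding beta_dilate_def by simp
  have "inv_dilate e {} = {}" unfolding inv_dilate_def by auto
  then show "{} \<notin> beta_dilate e p"
    using ultrafilter_nonempty[OF p] unfolding beta_dilate_def by auto
next
  fix A B assume A: "A \<in> beta_dilate e p" and "A \<subseteq> B" and B: "B \<subseteq> pos_nats"
  then have "inv_dilate e A \<subseteq> inv_dilate e B" unfolding inv_dilate_def by auto
  then have "inv_dilate e B \<in> p"
    using A ultrafilter_mono[OF p] inv_dilate_subset unfolding beta_dilate_def by blast
  then show "B \<in> beta_dilate e p" using B unfolding beta_dilate_def by simp
next
  fix A B assume AB: "A \<in> beta_dilate e p" "B \<in> beta_dilate e p"
  have "inv_dilate e (A \<inter> B) = inv_dilate e A \<inter> inv_dilate e B" unfolding inv_dilate_def by auto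
  then show "A \<inter> B \<in> beta_dilate e p"
    using AB ultrafilter_Int[OF p] unfolding beta_dilate_def by auto
next
  fix A :: "nat set" assume A: "A \<subseteq> pos_nats"
  have "inv_dilate e (pos_nats - A) = pos_nats - inv_dilate e A"
    using e unfolding inv_dilate_def by auto
  then show "A \<in> beta_dilate e p \<or> pos_nats - A \<in> beta_dilate e p"
    using A ultrafilter_cases[OF p inv_dilate_subset] unfolding beta_dilate_def by simp
qed

text \<open>Multiplication by \<open>e\<close> is an endomorphism of addition, and the distributive
  law passes to image ultrafilters. Consequently dilates of idempotents are idempotent.\<close>

lemma beta_dilate_beta_add:
  assumes p: "is_ultrafilter p" and q: "is_ultrafilter q" and e: "e \<in> pos_nats"
  shows "beta_dilate e (beta_add p q) = beta_add (beta_dilate e p) (beta_dilate e q)"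
proof -
  have "neg_shift n (inv_dilate e A) = inv_dilate e (neg_shift (e * n) A)" for n A
    using e unfolding neg_shift_def inv_dilate_def by (auto simp: distrib_left)
  moreover have "inv_dilate e {n \<in> pos_nats. R n} = {n \<in> pos_nats. R (e * n)}" for R
    using e unfolding inv_dilate_def by auto
  moreover have "{n \<in> pos_nats. R n} \<subseteq> pos_nats" for R by auto
  ultimately show ?thesis
    unfolding beta_dilate_def beta_add_def using neg_shift_subset inv_dilate_subset by simp
qed

text \<open>A member \<open>A\<close> of the dilate contains the \<open>e\<close>-fold dilate of its
  own preimage. That preimage is in \<open>p\<close>, so dilation invariance and closure under
  supersets put \<open>A\<close> into \<open>\<F>\<close>.\<close>

lemma beta_dilate_in_beta_family:
  assumes "is_family \<F>" "dilation_invariant \<F>" "p \<in> beta_family \<F>" "e \<in> pos_nats"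
  shows "beta_dilate e p \<in> beta_family \<F>"
proof -
  have p: "is_ultrafilter p" "p \<subseteq> \<F>" using assms(3) unfolding beta_family_def betaN_def by auto
  have "A \<in> \<F>" if A: "A \<in> beta_dilate e p" for A
  proof -
    have "inv_dilate e A \<in> \<F>" "A \<subseteq> pos_nats" using A p unfolding beta_dilate_def by auto
    moreover from this have "dilate e (inv_dilate e A) \<in> \<F>"
      using assms(2,4) unfolding dilation_invariant_def by blast
    moreover have "dilate e (inv_dilate e A) \<subseteq> A" unfolding dilate_def inv_dilate_def by blast
    ultimately show ?thesis using assms(1) unfolding is_family_def by blast
  qed
  then show ?thesis
    using ultrafilter_beta_dilate[OF p(1) assms(4)] unfolding beta_family_def betaN_def by blast
qed

section \<open>Construction of the sum subsystem\<close>

text \<open>This is the set usually written \<open>A\<close> with a star in the ultrafilter proof of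
  Hindman's theorem.\<close>

definition star_part :: "nat set set \<Rightarrow> nat set \<Rightarrow> nat set" where
  "star_part p A = {a \<in> A. neg_shift a A \<in> p}"

lemma star_part_mem:
  assumes p: "is_ultrafilter p" "beta_add p p = p" and A: "A \<in> p"
  shows "star_part p A \<in> p"
proof -
  have "{n \<in> pos_nats. neg_shift n A \<in> p} \<in> p" using A p(2) mem_beta_add by blast
  moreover have "star_part p A = A \<inter> {n \<in> pos_nats. neg_shift n A \<in> p}"
    using ultrafilter_subset[OF p(1) A] unfolding star_part_def by blast
  ultimately show ?thesis using ultrafilter_Int[OF p(1)] A by simp
qed

text \<open>Shifting commutes with taking star parts, and the shifted set
  \<open>neg_shift a A\<close> is in \<open>p\<close> by the choice of \<open>a\<close>. This lets
  the recursion continue after each new sum.\<close>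

lemma neg_shift_star_part_mem:
  assumes p: "is_ultrafilter p" "beta_add p p = p" and a: "a \<in> star_part p A"
  shows "neg_shift a (star_part p A) \<in> p"
proof -
  have "neg_shift a (star_part p A) = star_part p (neg_shift a A)"
    unfolding star_part_def neg_shift_neg_shift by (auto simp: neg_shift_def)
  then show ?thesis using star_part_mem[OF p] a unfolding star_part_def by simp
qed

text \<open>Sums are kept in \<open>star_part p A\<close>, because every sum reached must again
  admit a large set of continuations. Products only need to be in \<open>A\<close>, because
  \<open>quot\<close> supplies a large set of continuations for every positive factor.\<close>

lemma sum_subsystem_in_idempotent_member:
  assumes p: "is_ultrafilter p" "beta_add p p = p"
    and FSp: "\<And>m. m \<in> pos_nats \<Longrightarrow> FS x m \<in> p"
    and A: "A \<in> p" and quot: "\<And>e. e \<in> pos_nats \<Longrightarrow> inv_dilate e A \<in> p"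
  shows "\<exists>y. sum_subsystem y x \<and> FS y 1 \<union> FP y 1 \<subseteq> A"
proof -
  let ?A = "star_part p A"
  \<comment> \<open>\<open>H\<close> is the latest index block. The conditions on \<open>D\<close>
    and \<open>E\<close> ensure that finitely many members of \<open>p\<close> describe the
    admissible next terms.\<close>
  define Inv :: "nat set \<times> nat set \<times> nat set \<Rightarrow> bool" where
    "Inv = (\<lambda>(H, D, E). finite H \<and> H \<noteq> {} \<and> H \<subseteq> pos_nats \<and>
       finite D \<and> (\<forall>d\<in>D. neg_shift d ?A \<in> p) \<and> finite E \<and> E \<subseteq> pos_nats)"
  define Step :: "nat set \<times> nat set \<times> nat set \<Rightarrow> nat set \<times> nat set \<times> nat set \<Rightarrow> bool" where
    "Step = (\<lambda>(H, D, E) (H', D', E'). Max H < Min H' \<and>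
       (\<forall>d\<in>D. d + sum x H' \<in> ?A) \<and> (\<forall>e\<in>E. e * sum x H' \<in> A) \<and>
       D' = D \<union> (\<lambda>d. d + sum x H') ` D \<and> E' = E \<union> (\<lambda>e. e * sum x H') ` E)"
  \<comment> \<open>\<open>D\<close> and \<open>E\<close> collect the sums and products over all subsets of the terms chosen so far,
      the empty subset included; the index set \<open>H\<close> of the initial state is a dummy.\<close>
  have "\<exists>f. \<forall>n. (Inv (f n) \<and> (n = 0 \<longrightarrow> f n = ({1}, {0}, {1}))) \<and> Step (f n) (f (Suc n))"
  proof (rule dependent_nat_choice[where P = "\<lambda>n s. Inv s \<and> (n = 0 \<longrightarrow> s = ({1}, {0}, {1}))"
        and Q = "\<lambda>_. Step"])
    \<comment> \<open>The initial state has the empty sum 0 in \<open>D\<close>, for which the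
      condition of \<open>Inv\<close> reduces to \<open>?A\<close> being in
      \<open>p\<close>.\<close>
    have "neg_shift 0 ?A = ?A"
      using ultrafilter_subset[OF p(1) A] unfolding neg_shift_def star_part_def by auto
    then show "\<exists>s. Inv s \<and> (0 = (0::nat) \<longrightarrow> s = ({1}, {0}, {1}))"
      using star_part_mem[OF p A] unfolding Inv_def by auto
  next
    fix s and n :: nat
    assume s: "Inv s \<and> (n = 0 \<longrightarrow> s = ({1}, {0}, {1}))"
    obtain H D E where sE: "s = (H, D, E)" by (cases s)
    have inv: "finite H" "H \<noteq> {}" "finite D" "finite E" "E \<subseteq> pos_nats"
      "\<And>d. d \<in> D \<Longrightarrow> neg_shift d ?A \<in> p"
      using s unfolding sE Inv_def by auto
    \<comment> \<open>\<open>?X\<close> handles the sums and \<open>?Y\<close> the products;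
      intersecting with the tail \<open>FS x ?m\<close> makes the new term a sum over a block
      strictly after \<open>H\<close>.\<close>
    let ?X = "{z \<in> pos_nats. \<forall>d\<in>D. z \<in> neg_shift d ?A}"
    let ?Y = "{z \<in> pos_nats. \<forall>e\<in>E. z \<in> inv_dilate e A}"
    let ?m = "Suc (Max H)"
    have "?X \<in> p" by (rule ultrafilter_INT[OF p(1) inv(3,6)])
    moreover have "?Y \<in> p" by (rule ultrafilter_INT[OF p(1) inv(4) quot]) (rule subsetD[OF inv(5)])
    ultimately have "?X \<inter> ?Y \<in> p" by (rule ultrafilter_Int[OF p(1)])
    then have "?X \<inter> ?Y \<inter> FS x ?m \<in> p" by (rule ultrafilter_Int[OF p(1) _ FSp]) simp
    from ultrafilter_nonempty[OF p(1) this]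
    obtain z where z: "z \<in> ?X" "z \<in> ?Y" "z \<in> FS x ?m" by auto
    from z(3) obtain H' where H': "z = sum x H'" "finite H'" "H' \<noteq> {}" "H' \<subseteq> {?m..}"
      unfolding FS_def by auto
    have DA: "d + z \<in> ?A" if "d \<in> D" for d using z(1) that unfolding neg_shift_def by simp
    have EA: "e * z \<in> A" if "e \<in> E" for e using z(2) that unfolding inv_dilate_def by simp
    let ?D = "D \<union> (\<lambda>d. d + sum x H') ` D" and ?E = "E \<union> (\<lambda>e. e * sum x H') ` E"
    have "Min H' \<in> {?m..}" using Min_in[OF H'(2,3)] by (rule subsetD[OF H'(4)])
    then have "Step s (H', ?D, ?E)" using DA EA unfolding sE Step_def H'(1) by simp
    moreover have "Inv (H', ?D, ?E)"
    proof -
      have "neg_shift d ?A \<in> p" if "d \<in> ?D" for d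
        using that inv(6) neg_shift_star_part_mem[OF p DA] unfolding H'(1) by auto
      moreover have "e \<in> pos_nats" if "e \<in> ?E" for e
        using that inv(5) subsetD[OF ultrafilter_subset[OF p(1) A] EA] unfolding H'(1) by blast
      then have "?E \<subseteq> pos_nats" by (rule subsetI)
      moreover have "{?m..} \<subseteq> pos_nats" by auto
      then have "H' \<subseteq> pos_nats" by (rule subset_trans[OF H'(4)])
      ultimately show ?thesis using H'(2,3) inv(3,4) unfolding Inv_def by simp
    qed
    ultimately show "\<exists>t. (Inv t \<and> (Suc n = 0 \<longrightarrow> t = ({1}, {0}, {1}))) \<and> Step s t"
      by (intro exI[of _ "(H', ?D, ?E)"]) simp
  qed
  then obtain f where f: "\<And>n. Inv (f n)" "f 0 = ({1}, {0}, {1})" "\<And>n. Step (f n) (f (Suc n))"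
    by metis
  define H where "H n = fst (f n)" for n
  define D where "D n = fst (snd (f n))" for n
  define E where "E n = snd (snd (f n))" for n
  define y where "y n = sum x (H n)" for n
  have feq: "f n = (H n, D n, E n)" for n unfolding H_def D_def E_def by simp
  have zero: "0 \<in> D 0" "1 \<in> E 0" using f(2) unfolding D_def E_def by auto
  have Hn: "finite (H n) \<and> H n \<noteq> {} \<and> H n \<subseteq> pos_nats" for n
    using f(1)[of n] unfolding feq Inv_def by simp
  have step: "Max (H n) < Min (H (Suc n))" "\<And>d. d \<in> D n \<Longrightarrow> d + y (Suc n) \<in> ?A"
    "\<And>e. e \<in> E n \<Longrightarrow> e * y (Suc n) \<in> A"
    "D (Suc n) = D n \<union> (\<lambda>d. d + y (Suc n)) ` D n"
    "E (Suc n) = E n \<union> (\<lambda>e. e * y (Suc n)) ` E n" for n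
    using f(3)[of n] unfolding feq Step_def y_def by auto
  \<comment> \<open>Index sets start at 1, so the term \<open>y 0\<close> of the dummy block never
    enters.\<close>
  have partial: "sum y K \<in> D n \<and> prod y K \<in> E n" if "K \<subseteq> {1..n}" for n K
    using that
  proof (induction n arbitrary: K)
    case 0
    then show ?case using zero by simp
  next
    case (Suc n)
    have fin: "finite K" using Suc.prems finite_subset by blast
    show ?case
    proof (cases "Suc n \<in> K")
      case True
      have "K - {Suc n} \<subseteq> {1..n}" using Suc.prems by (auto simp: le_Suc_eq)
      then have "sum y (K - {Suc n}) \<in> D n" "prod y (K - {Suc n}) \<in> E n" using Suc.IH by auto
      moreover have "sum y K = sum y (K - {Suc n}) + y (Suc n)"
        "prod y K = prod y (K - {Suc n}) * y (Suc n)"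
        using fin True by (simp_all add: sum.remove prod.remove add.commute mult.commute)
      ultimately show ?thesis unfolding step(4,5) by auto
    next
      case False
      then have "K \<subseteq> {1..n}" using Suc.prems by (force simp: le_Suc_eq)
      then show ?thesis using Suc.IH unfolding step(4,5) by blast
    qed
  qed
  have "sum y K \<in> A \<and> prod y K \<in> A" if K: "finite K" "K \<noteq> {}" "K \<subseteq> {1..}" for K
  proof -
    \<comment> \<open>The last term is split off. The remaining index set may be empty, in which
      case the initial 0 in \<open>D\<close> and 1 in \<open>E\<close> are used.\<close>
    obtain n where n: "Max K = Suc n"
      using Max_in[OF K(1,2)] K(3) by (cases "Max K") auto
    have mem: "Suc n \<in> K" using Max_in[OF K(1,2)] n by simp
    have "K - {Suc n} \<subseteq> {1..n}"
    proof
      fix i assume "i \<in> K - {Suc n}"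
      then show "i \<in> {1..n}" using Max_ge[OF K(1), of i] K(3) n by auto
    qed
    then have "sum y (K - {Suc n}) + y (Suc n) \<in> ?A" "prod y (K - {Suc n}) * y (Suc n) \<in> A"
      using partial step(2,3) by blast+
    moreover have "sum y K = sum y (K - {Suc n}) + y (Suc n)"
      "prod y K = prod y (K - {Suc n}) * y (Suc n)"
      using K(1) mem by (simp_all add: sum.remove prod.remove add.commute mult.commute)
    ultimately show ?thesis unfolding star_part_def by simp
  qed
  then have "FS y 1 \<union> FP y 1 \<subseteq> A" unfolding FS_def FP_def by blast
  moreover have "sum_subsystem y x"
    unfolding sum_subsystem_def using Hn step(1) y_def by (metis Suc_eq_plus1)
  ultimately show ?thesis by blast
qed

theorem theorem3p11:
  fixes \<F> :: "nat set set" and x :: "nat \<Rightarrow> nat" and A :: "nat set"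
  assumes "is_family \<F>"
    and "ramsey_property \<F>"
    and "inverse_shift_invariant \<F>"
    and "dilation_invariant \<F>"
    and "subsemigroup_betaN (beta_family \<F>)"
    and "pos_sequence x"
    and "minimal_sequence \<F> x"
    and "essential_star_set \<F> A"
  shows "\<exists>y. sum_subsystem y x \<and> FS y 1 \<union> FP y 1 \<subseteq> A"
proof -
  let ?C = "(\<lambda>m. cl_beta (FS x m)) ` pos_nats"
  let ?T = "\<Inter>?C \<inter> beta_family \<F>"
  \<comment> \<open>The set \<open>?T\<close> is rewritten as a single intersection of a non-empty
    collection of closed sets.\<close>
  have "beta_closed (\<Inter>(insert (beta_family \<F>) ?C))"
    by (rule beta_closed_Inter)
      (use beta_closed_beta_family beta_closed_cl_beta FS_subset_pos_nats[OF assms(6)] in auto)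
  then have "beta_closed ?T" by (simp add: Int_commute)
  moreover have "?T \<noteq> {}" using assms(7) unfolding minimal_sequence_def .
  moreover have "subsemigroup_betaN ?T"
    using subsemigroup_FS_tails[OF assms(6)] assms(5) unfolding subsemigroup_betaN_def by blast
  ultimately obtain p where p: "p \<in> ?T" "beta_add p p = p"
    using idempotent_in_beta_closed_subsemigroup by blast
  have fam: "p \<in> beta_family \<F>" and uf: "is_ultrafilter p"
    using p(1) unfolding beta_family_def betaN_def by auto
  have FSp: "FS x m \<in> p" if "m \<in> pos_nats" for m using p(1) that unfolding cl_beta_def by blast
  have quot: "inv_dilate e A \<in> p" if e: "e \<in> pos_nats" for e
  proof -
    \<comment> \<open>The dilate is an idempotent of \<open>beta_family \<F>\<close>, so the
      essential star property applies to it and not only to \<open>p\<close>.\<close>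
    have "beta_add (beta_dilate e p) (beta_dilate e p) = beta_dilate e p"
      using beta_dilate_beta_add[OF uf uf e] p(2) by simp
    then have "A \<in> beta_dilate e p"
      using assms(8) beta_dilate_in_beta_family[OF assms(1,4) fam e]
      unfolding essential_star_set_def by blast
    then show ?thesis unfolding beta_dilate_def by blast
  qed
  have "A \<in> p" using assms(8) fam p(2) unfolding essential_star_set_def by blast
  then show ?thesis using sum_subsystem_in_idempotent_member[OF uf p(2) FSp _ quot] by blast
qed

end
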